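(* Let $f\colon A\to B$ be an extension (surjective morphism) of racks (or in particular of quandles). Then the kernel pair $\mathrm C_1(f)$ of the domain component $\eta^1_A$ of the unit $\eta^1_f=(\eta^1_A,\mathrm{id}_B)$ commutes with every congruence on $A$ in racks (and so also in particular in quandles): for every congruence $R$ on $A$, $\mathrm C_1(f)\circ R=R\circ\mathrm C_1(f)$.
   Context: A rack is a set $X$ with two binary operations $\triangleleft,\triangleleft^{-1}$ such that $(x\triangleleft y)\triangleleft^{-1}y = x = (x\triangleleft^{-1}y)\triangleleft y$ and $(x\triangleleft y)\triangleleft z=(x\triangleleft z)\triangleleft(y\triangleleft z)$; a quandle is a rack with $x\triangleleft x=x$. A congruence is an equivalence relation compatible with the operations; $\circ$ is composition of relations. For an extension $f\colon A\to B$, $\mathrm C_1(f)$ is the equivalence relation on $A$ generated by the pairs $\big((x\triangleleft a)\triangleleft^{-1}b,x\big)$ with $x,a,b\in A$ and $f(a)=f(b)$; it is a congruence contained in the kernel pair of $f$, and $\eta^1_A\colon A\to A/\mathrm C_1(f)$ is the quotient map. The pair $\eta^1_f=(\eta^1_A,\mathrm{id}_B)$ is the unit at $f$ of the reflection of extensions onto central extensions (coverings), which sends $f$ to the induced map $A/\mathrm C_1(f)\to B$. *)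

theory Defs
  imports "HOL-Algebra.Congruence"
begin

record 'a rack = "'a partial_object" +
  tri :: "['a, 'a] \<Rightarrow> 'a" (infixl \<open>\<lhd>\<index>\<close> 70)
  itri :: "['a, 'a] \<Rightarrow> 'a" (infixl \<open>\<lhd>\<^sup>-\<^sup>1\<index>\<close> 70)

locale rack =
  fixes X (structure)
  assumes tri_closed: "\<lbrakk>x \<in> carrier X; y \<in> carrier X\<rbrakk> \<Longrightarrow> x \<lhd> y \<in> carrier X"
    and itri_closed: "\<lbrakk>x \<in> carrier X; y \<in> carrier X\<rbrakk> \<Longrightarrow> x \<lhd>\<^sup>-\<^sup>1 y \<in> carrier X"
    and tri_itri: "\<lbrakk>x \<in> carrier X; y \<in> carrier X\<rbrakk> \<Longrightarrow> (x \<lhd> y) \<lhd>\<^sup>-\<^sup>1 y = x"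
    and itri_tri: "\<lbrakk>x \<in> carrier X; y \<in> carrier X\<rbrakk> \<Longrightarrow> (x \<lhd>\<^sup>-\<^sup>1 y) \<lhd> y = x"
    and self_distrib: "\<lbrakk>x \<in> carrier X; y \<in> carrier X; z \<in> carrier X\<rbrakk>
      \<Longrightarrow> (x \<lhd> y) \<lhd> z = (x \<lhd> z) \<lhd> (y \<lhd> z)"

locale quandle = rack +
  assumes idem: "x \<in> carrier X \<Longrightarrow> x \<lhd> x = x"

locale rack_extension = dom: rack A + cod: rack B
  for A :: "('a, 'm) rack_scheme" and B :: "('b, 'n) rack_scheme" and f :: "'a \<Rightarrow> 'b" +
  assumes surj: "f ` carrier A = carrier B"
    and hom_tri: "\<lbrakk>x \<in> carrier A; y \<in> carrier A\<rbrakk> \<Longrightarrow> f (x \<lhd>\<^bsub>A\<^esub> y) = f x \<lhd>\<^bsub>B\<^esub> f y"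
    and hom_itri: "\<lbrakk>x \<in> carrier A; y \<in> carrier A\<rbrakk>
      \<Longrightarrow> f (x \<lhd>\<^sup>-\<^sup>1\<^bsub>A\<^esub> y) = f x \<lhd>\<^sup>-\<^sup>1\<^bsub>B\<^esub> f y"

text \<open>
  Quandles have the same operations as racks, so morphisms and congruences of quandles are
  those of the underlying racks. An extension of quandles is thus an extension of racks, and
  what holds for all rack extensions and rack congruences applies to quandles by inheritance.
\<close>

locale quandle_extension = rack_extension A B f + dom: quandle A + cod: quandle B
  for A :: "('a, 'm) rack_scheme" and B :: "('b, 'n) rack_scheme" and f :: "'a \<Rightarrow> 'b"

definition rack_congruence :: "('a, 'm) rack_scheme \<Rightarrow> 'a rel \<Rightarrow> bool" where
  "rack_congruence A R \<longleftrightarrow> equiv (carrier A) R \<and>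
    (\<forall>(x, x') \<in> R. \<forall>(y, y') \<in> R.
       (x \<lhd>\<^bsub>A\<^esub> y, x' \<lhd>\<^bsub>A\<^esub> y') \<in> R \<and> (x \<lhd>\<^sup>-\<^sup>1\<^bsub>A\<^esub> y, x' \<lhd>\<^sup>-\<^sup>1\<^bsub>A\<^esub> y') \<in> R)"

definition kernel_pair :: "('a, 'm) rack_scheme \<Rightarrow> ('a \<Rightarrow> 'c) \<Rightarrow> 'a rel" where
  "kernel_pair A h = {(x, y). x \<in> carrier A \<and> y \<in> carrier A \<and> h x = h y}"

definition equiv_generated :: "'a set \<Rightarrow> 'a rel \<Rightarrow> 'a rel" where
  "equiv_generated S P = \<Inter> {E. equiv S E \<and> P \<subseteq> E}"

definition C1 :: "('a, 'm) rack_scheme \<Rightarrow> ('a \<Rightarrow> 'b) \<Rightarrow> 'a rel" where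
  "C1 A f = equiv_generated (carrier A)
    {((x \<lhd>\<^bsub>A\<^esub> a) \<lhd>\<^sup>-\<^sup>1\<^bsub>A\<^esub> b, x) | x a b.
       x \<in> carrier A \<and> a \<in> carrier A \<and> b \<in> carrier A \<and> f a = f b}"

text \<open>
  The domain component of the unit at \<^term>\<open>f\<close> of the reflection of extensions onto
  coverings: the canonical projection of \<^term>\<open>carrier A\<close> onto \<^term>\<open>carrier A // C1 A f\<close>.
\<close>

definition eta1 :: "('a, 'm) rack_scheme \<Rightarrow> ('a \<Rightarrow> 'b) \<Rightarrow> 'a \<Rightarrow> 'a set" where
  "eta1 A f x = C1 A f `` {x}"

end

theory Submission
  imports Defs
begin

text \<open>
  The pairs generating \<^term>\<open>C1 A f\<close> are \<open>(p x, x)\<close>, where \<open>p\<close> runs through the displacements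
  \<open>x \<mapsto> (x \<lhd> a) \<lhd>\<^sup>-\<^sup>1 b\<close> with \<open>f a = f b\<close>. The inverse of such a map is again one, with
  \<open>a\<close> and \<open>b\<close> exchanged, and \<open>a = b\<close> gives the identity. Hence the generating relation is
  already reflexive and symmetric, and \<^term>\<open>C1 A f\<close> is its transitive closure: two elements are
  related iff finitely many displacements carry one to the other.

  Commutation follows because the maps \<open>p\<close> are built from the operations: every congruence
  \<open>R\<close> is stable under them. From \<open>(p x, x)\<close> and \<open>(x, y) \<in> R\<close> one gets \<open>(p x, p y) \<in> R\<close>
  and the generating pair \<open>(p y, y)\<close>, so \<open>R\<close> can be moved across one displacement
  (\<open>displacement_rel_O_congruence\<close>), hence across any finite chain of them (\<open>trancl_O_subset\<close>).
  This is one of the two inclusions, and the other is its converse, since both relations are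
  symmetric.
\<close>

text \<open>
  The transitive closure is taken rather than the reflexive one, which would add the diagonal
  outside \<open>S\<close>; reflexivity on \<open>S\<close> is inherited from \<open>P\<close>.
\<close>

lemma equiv_trancl:
  assumes "P \<subseteq> S \<times> S" "refl_on S P" "sym P"
  shows "equiv S (P\<^sup>+)"
proof (rule equivI)
  show "P\<^sup>+ \<subseteq> S \<times> S"
    using assms(1) by (rule trancl_subset_Sigma)
  show "refl_on S (P\<^sup>+)"
    using assms(2) by (auto simp: refl_on_def)
  show "sym (P\<^sup>+)"
    using assms(3) by (rule sym_trancl)
  show "trans (P\<^sup>+)"
    by (rule trans_trancl)
qed

lemma equiv_generated_eq_trancl:
  assumes "P \<subseteq> S \<times> S" "refl_on S P" "sym P"
  shows "equiv_generated S P = P\<^sup>+"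
proof
  show "equiv_generated S P \<subseteq> P\<^sup>+"
    unfolding equiv_generated_def by (rule Inter_lower) (auto intro: equiv_trancl[OF assms])
  have "P\<^sup>+ \<subseteq> E" if "equiv S E" "P \<subseteq> E" for E
    using that by (metis equiv_def trancl_id trancl_mono_subset)
  then show "P\<^sup>+ \<subseteq> equiv_generated S P"
    unfolding equiv_generated_def by blast
qed

lemma trancl_O_subset:
  assumes "P O R \<subseteq> R O P"
  shows "P\<^sup>+ O R \<subseteq> R O P\<^sup>+"
proof -
  have "\<exists>z. (x, z) \<in> R \<and> (z, y') \<in> P\<^sup>+" if "(x, y) \<in> P\<^sup>+" "(y, y') \<in> R" for x y y'
    using that
  proof (induction arbitrary: y' rule: trancl_induct)
    case (base y)
    then show ?case using assms by blast
  next
    case (step y z)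
    then obtain w where "(y, w) \<in> R" "(w, y') \<in> P" using assms by blast
    then show ?case using step.IH by (meson trancl.trancl_into_trancl)
  qed
  then show ?thesis by blast
qed

lemma sym_commute:
  assumes "sym C" "sym R" "C O R \<subseteq> R O C"
  shows "C O R = R O C"
proof -
  have "(C O R)\<inverse> \<subseteq> (R O C)\<inverse>"
    using assms(3) by blast
  then have "R O C \<subseteq> C O R"
    using assms(1,2) by (simp add: converse_relcomp sym_conv_converse_eq)
  with assms(3) show ?thesis by blast
qed

definition displacement_rel :: "('a, 'm) rack_scheme \<Rightarrow> ('a \<Rightarrow> 'b) \<Rightarrow> 'a rel" where
  "displacement_rel A f = {((x \<lhd>\<^bsub>A\<^esub> a) \<lhd>\<^sup>-\<^sup>1\<^bsub>A\<^esub> b, x) | x a b.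
     x \<in> carrier A \<and> a \<in> carrier A \<and> b \<in> carrier A \<and> f a = f b}"

context rack
begin

lemma displacement_rel_subset: "displacement_rel X f \<subseteq> carrier X \<times> carrier X"
  by (auto simp: displacement_rel_def tri_closed itri_closed)

lemma refl_displacement_rel: "refl_on (carrier X) (displacement_rel X f)"
proof (rule refl_onI)
  fix x assume x: "x \<in> carrier X"
  have "(x \<lhd> x) \<lhd>\<^sup>-\<^sup>1 x = x" using x x by (rule tri_itri)
  with x show "(x, x) \<in> displacement_rel X f"
    unfolding displacement_rel_def by force
qed

lemma sym_displacement_rel: "sym (displacement_rel X f)"
proof (rule symI)
  fix y x assume "(y, x) \<in> displacement_rel X f"
  then obtain a b where y: "y = (x \<lhd> a) \<lhd>\<^sup>-\<^sup>1 b"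
    and in_carrier: "x \<in> carrier X" "a \<in> carrier X" "b \<in> carrier X" and fib: "f a = f b"
    by (auto simp: displacement_rel_def)
  have "(y \<lhd> b) \<lhd>\<^sup>-\<^sup>1 a = x" "y \<in> carrier X"
    using in_carrier by (simp_all add: y itri_tri tri_itri tri_closed itri_closed)
  with in_carrier fib show "(x, y) \<in> displacement_rel X f"
    unfolding displacement_rel_def by force
qed

lemma C1_eq_trancl: "C1 X f = (displacement_rel X f)\<^sup>+"
  using equiv_generated_eq_trancl[OF displacement_rel_subset refl_displacement_rel sym_displacement_rel]
  unfolding C1_def displacement_rel_def .

lemma equiv_C1: "equiv (carrier X) (C1 X f)"
  unfolding C1_eq_trancl
  using displacement_rel_subset refl_displacement_rel sym_displacement_rel by (rule equiv_trancl)

lemma kernel_pair_eta1: "kernel_pair X (eta1 X f) = C1 X f"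
  using eq_equiv_class_iff[OF equiv_C1] equiv_type[OF equiv_C1]
  unfolding kernel_pair_def eta1_def by blast

end

text \<open>
  The parameters \<open>a\<close>, \<open>b\<close> are kept when passing from \<open>x\<close> to a congruent \<open>y\<close>, so the condition
  \<open>f a = f b\<close> survives although \<open>R\<close> may identify elements of different fibres of \<open>f\<close>.
\<close>

lemma displacement_rel_O_congruence:
  assumes "rack_congruence A R"
  shows "displacement_rel A f O R \<subseteq> R O displacement_rel A f"
proof -
  have equiv: "equiv (carrier A) R"
    and tri: "\<And>x x' y y'. (x, x') \<in> R \<Longrightarrow> (y, y') \<in> R \<Longrightarrow> (x \<lhd>\<^bsub>A\<^esub> y, x' \<lhd>\<^bsub>A\<^esub> y') \<in> R"
    and itri: "\<And>x x' y y'. (x, x') \<in> R \<Longrightarrow> (y, y') \<in> R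
      \<Longrightarrow> (x \<lhd>\<^sup>-\<^sup>1\<^bsub>A\<^esub> y, x' \<lhd>\<^sup>-\<^sup>1\<^bsub>A\<^esub> y') \<in> R"
    using assms by (auto simp: rack_congruence_def)
  have "((x \<lhd>\<^bsub>A\<^esub> a) \<lhd>\<^sup>-\<^sup>1\<^bsub>A\<^esub> b, y) \<in> R O displacement_rel A f"
    if "(x, y) \<in> R" "a \<in> carrier A" "b \<in> carrier A" "f a = f b" for x y a b
  proof (rule relcompI)
    have "(a, a) \<in> R" "(b, b) \<in> R"
      using equiv that by (auto elim: equivE dest: refl_onD)
    then show "((x \<lhd>\<^bsub>A\<^esub> a) \<lhd>\<^sup>-\<^sup>1\<^bsub>A\<^esub> b, (y \<lhd>\<^bsub>A\<^esub> a) \<lhd>\<^sup>-\<^sup>1\<^bsub>A\<^esub> b) \<in> R"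
      using that(1) by (intro tri itri)
    have "y \<in> carrier A"
      using equiv_type[OF equiv] that(1) by blast
    then show "((y \<lhd>\<^bsub>A\<^esub> a) \<lhd>\<^sup>-\<^sup>1\<^bsub>A\<^esub> b, y) \<in> displacement_rel A f"
      using that(2-4) by (auto simp: displacement_rel_def)
  qed
  then show ?thesis
    by (auto simp: displacement_rel_def[of A f])
qed

theorem proposition3p4p2p1:
  fixes A :: "('a, 'm) rack_scheme" and B :: "('b, 'n) rack_scheme" and f :: "'a \<Rightarrow> 'b"
  assumes "rack_extension A B f"
  shows "kernel_pair A (eta1 A f) = C1 A f \<and>
    (\<forall>R. rack_congruence A R \<longrightarrow> C1 A f O R = R O C1 A f)"
proof (intro conjI allI impI)
  interpret rack_extension A B f by fact
  show "kernel_pair A (eta1 A f) = C1 A f"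
    by (rule dom.kernel_pair_eta1)
  fix R assume R: "rack_congruence A R"
  show "C1 A f O R = R O C1 A f"
  proof (rule sym_commute)
    show "sym (C1 A f)"
      using dom.equiv_C1 by (rule equivE)
    show "sym R"
      using R by (auto simp: rack_congruence_def elim: equivE)
    show "C1 A f O R \<subseteq> R O C1 A f"
      unfolding dom.C1_eq_trancl
      by (rule trancl_O_subset[OF displacement_rel_O_congruence[OF R]])
  qed
qed

end
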